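(* Every weakly acyclic skew-symmetric graph $G$ is either strongly acyclic or admits a weak separator $(A,B,Z)$. Conversely, if $(A,B,Z)$ is a weak separator for a skew-symmetric graph $G$, then $G$ is weakly acyclic.
   Context: All graphs are finite; parallel arcs are allowed. A skew-symmetric graph is a digraph $G$ (node set $V_G$, arc set $A_G$) endowed with an involution $\sigma$ on $V_G\cup A_G$, mapping nodes to nodes and arcs to arcs, with no fixed nodes and no fixed arcs, such that for each arc $a$ from $u$ to $v$, $\sigma(a)$ is an arc from $\sigma(v)$ to $\sigma(u)$. We write $x'=\sigma(x)$ (the mate of $x$) and $X'=\sigma(X)$ for a set $X$ of nodes; $X$ is self-symmetric if $X'=X$. $G[X]$ is the directed subgraph induced by $X$; if $X'=X$ it is a skew-symmetric graph with the restricted symmetry. A cycle is a closed directed walk (nodes and arcs may repeat); a circuit is a node-simple directed cycle. An arc-simple walk or cycle is regular if it contains no pair of arcs $a,a'$ that are mates (symmetric nodes are allowed). $G$ is strongly acyclic if it has no directed cycles; $G$ is weakly acyclic if it has no regular circuits. A weak separator for $G$ is a triple $(A,B,Z)$ of node sets such that $V_G$ is partitioned into the four sets $A,B,Z,Z'$ ($Z$ may be empty) and: (i) $A$ and $B$ are self-symmetric and nonempty; (ii) exactly one pair of symmetric arcs (an arc and its mate) connects $A$ and $B$; (iii) $G[A]$ and $G[B]$ are weakly acyclic; (iv) no arc leaves $Z$ and no arc enters $Z'$.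
   Formalization: The converse is proved under the added hypothesis that G[Z] is strongly acyclic; without it the converse fails, e.g. when Z contains a directed circuit, and the hypothesis is necessary for G to be weakly acyclic. *)

theory Defs
  imports "Graph_Theory.Graph_Theory"
begin

text \<open>
  The involution on the disjoint union of nodes and arcs is given by its two restrictions:
  \<open>mv\<close> on nodes and \<open>ma\<close> on arcs. Their values outside \<open>verts G\<close> and
  \<open>arcs G\<close> are irrelevant.
\<close>

locale skew_symmetric_graph = fin_digraph G
  for G :: "('a, 'b) pre_digraph" (structure) +
  fixes mv :: "'a \<Rightarrow> 'a" and ma :: "'b \<Rightarrow> 'b"
  assumes mv_in_verts: "v \<in> verts G \<Longrightarrow> mv v \<in> verts G"
    and mv_mv: "v \<in> verts G \<Longrightarrow> mv (mv v) = v"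
    and mv_neq: "v \<in> verts G \<Longrightarrow> mv v \<noteq> v"
    and ma_in_arcs: "a \<in> arcs G \<Longrightarrow> ma a \<in> arcs G"
    and ma_ma: "a \<in> arcs G \<Longrightarrow> ma (ma a) = a"
    and ma_neq: "a \<in> arcs G \<Longrightarrow> ma a \<noteq> a"
    and tail_ma: "a \<in> arcs G \<Longrightarrow> tail G (ma a) = mv (head G a)"
    and head_ma: "a \<in> arcs G \<Longrightarrow> head G (ma a) = mv (tail G a)"

definition regular :: "('b \<Rightarrow> 'b) \<Rightarrow> 'b list \<Rightarrow> bool" where
  "regular ma p \<longleftrightarrow> distinct p \<and> (\<forall>a\<in>set p. ma a \<notin> set p)"

text \<open>
  A cycle in the sense of an arbitrary nonempty closed directed walk is \<open>closed_w\<close>;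
  a circuit (node-simple directed cycle) is what Graph-Theory calls \<open>cycle\<close>.
\<close>

definition strongly_acyclic :: "('a, 'b) pre_digraph \<Rightarrow> bool" where
  "strongly_acyclic G \<longleftrightarrow> (\<nexists>p. wf_digraph.closed_w G p)"

definition weakly_acyclic :: "('a, 'b) pre_digraph \<Rightarrow> ('b \<Rightarrow> 'b) \<Rightarrow> bool" where
  "weakly_acyclic G ma \<longleftrightarrow> (\<nexists>p. pre_digraph.cycle G p \<and> regular ma p)"

definition self_symmetric :: "('a \<Rightarrow> 'a) \<Rightarrow> 'a set \<Rightarrow> bool" where
  "self_symmetric mv X \<longleftrightarrow> mv ` X = X"

definition connecting_arcs :: "('a, 'b) pre_digraph \<Rightarrow> 'a set \<Rightarrow> 'a set \<Rightarrow> 'b set" where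
  "connecting_arcs G A B = {a \<in> arcs G. (tail G a \<in> A \<and> head G a \<in> B) \<or>
                                        (tail G a \<in> B \<and> head G a \<in> A)}"

definition weak_separator ::
  "('a, 'b) pre_digraph \<Rightarrow> ('a \<Rightarrow> 'a) \<Rightarrow> ('b \<Rightarrow> 'b) \<Rightarrow> 'a set \<Rightarrow> 'a set \<Rightarrow> 'a set \<Rightarrow> bool" where
  "weak_separator G mv ma A B Z \<longleftrightarrow>
     A \<union> B \<union> Z \<union> mv ` Z = verts G \<and>
     A \<inter> B = {} \<and> A \<inter> Z = {} \<and> A \<inter> mv ` Z = {} \<and>
     B \<inter> Z = {} \<and> B \<inter> mv ` Z = {} \<and> Z \<inter> mv ` Z = {} \<and>
     self_symmetric mv A \<and> A \<noteq> {} \<and>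
     self_symmetric mv B \<and> B \<noteq> {} \<and>
     (\<exists>a\<in>arcs G. connecting_arcs G A B = {a, ma a}) \<and>
     weakly_acyclic (G \<restriction> A) ma \<and> weakly_acyclic (G \<restriction> B) ma \<and>
     \<not> (\<exists>a\<in>arcs G. tail G a \<in> Z \<and> head G a \<notin> Z) \<and>
     \<not> (\<exists>a\<in>arcs G. tail G a \<notin> mv ` Z \<and> head G a \<in> mv ` Z)"

end

theory Submission
  imports Defs
begin

text \<open>
  Forward direction: take \<open>Z\<close> maximal among the node sets that no arc leaves, that are disjoint
  from their mates and that avoid the nodes of some closed walk and their mates. By maximality, every
  node of the subgraph \<open>H\<close> induced by the remaining nodes has an outgoing arc in \<open>H\<close>, so it
  suffices to find a bridge in \<open>H\<close>: a self-symmetric node set joined to the rest of \<open>H\<close> by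
  exactly one pair of mates. This is a bidirected version of Kotzig's theorem on unique perfect
  matchings and is proved by shrinking blossoms. Keep a partition of the nodes into mate pairs and
  blossoms, a blossom being a self-symmetric set all of whose nodes are reachable by regular walks
  from a base. Without a bridge, a regular walk can always be prolonged from class to class. When it
  first returns to a class, weak acyclicity rules out that it closes up to a regular cycle, and then
  all classes on the loop merge into a single blossom.

  Converse: a regular cycle cannot meet \<open>Z\<close> or \<open>Z'\<close> as \<open>G[Z]\<close> has no cycles, and
  within \<open>A \<union> B\<close> it would have to cross from \<open>A\<close> to \<open>B\<close> and back, thus using both
  arcs of the connecting pair.
\<close>

section \<open>Regular walks\<close>

context skew_symmetric_graph
begin

lemma self_symmetricI:
  assumes "X \<subseteq> verts G" "\<And>v. v \<in> X \<Longrightarrow> mv v \<in> X"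
  shows "self_symmetric mv X"
  unfolding self_symmetric_def
proof (intro equalityI subsetI)
  fix v assume "v \<in> X"
  then have "v = mv (mv v)" "mv v \<in> X" using assms mv_mv by auto
  then show "v \<in> mv ` X" by (rule image_eqI)
qed (use assms in auto)

lemma regular_mono: "regular ma p \<Longrightarrow> distinct q \<Longrightarrow> set q \<subseteq> set p \<Longrightarrow> regular ma q"
  by (auto simp: regular_def)

text \<open>If a node repeats, the walk without its first arc contains a nonempty closed subwalk.
  This is strictly shorter and inherits regularity, so induction on the length applies.\<close>

lemma regular_closed_imp_cycle:
  assumes "awalk u p u" "p \<noteq> []" "regular ma p"
  shows "\<exists>q. cycle q \<and> regular ma q"
  using assms
proof (induction "length p" arbitrary: p u rule: less_induct)
  case less
  show ?case
  proof (cases "distinct (tl (awalk_verts u p))")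
    case True
    then show ?thesis using less.prems by (auto simp: cycle_def)
  next
    case False
    obtain e es where p: "p = e # es" using less.prems by (cases p) auto
    then have "awalk (head G e) es u" "\<not> distinct (awalk_verts (head G e) es)"
      using less.prems False by (auto simp: awalk_Cons_iff)
    then obtain q r s where d: "es = q @ r @ s" "0 < length r" "\<exists>w. awalk w r w"
      using awalk_not_distinct_decomp[of "head G e" es u] by blast
    moreover have "regular ma r"
      using less.prems(3) p d by (auto intro!: regular_mono[of p] simp: regular_def)
    ultimately show ?thesis
      using less.hyps[of r] p by auto
  qed
qed

lemma awalk_mate: "awalk u p v \<Longrightarrow> awalk (mv v) (map ma (rev p)) (mv u)"
proof (induction p arbitrary: u)
  case Nil
  then show ?case by (auto simp: awalk_Nil_iff mv_in_verts)
next
  case (Cons a p)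
  then have a: "a \<in> arcs G" "tail G a = u" "awalk (mv v) (map ma (rev p)) (mv (head G a))"
    by (auto simp: awalk_Cons_iff)
  then have "awalk (mv (head G a)) [ma a] (mv u)"
    using arc_implies_awalk[of "ma a"] ma_in_arcs tail_ma head_ma by auto
  then show ?case using awalk_appendI[OF a(3)] by simp
qed

lemma regular_mate:
  assumes "set p \<subseteq> arcs G" "regular ma p"
  shows "regular ma (map ma (rev p))"
proof -
  have "inj_on ma (set p)" by (metis assms(1) inj_onI ma_ma subsetD)
  then show ?thesis
    using assms by (auto simp: regular_def distinct_map subset_iff) (metis ma_ma)
qed

text \<open>The set \<open>E\<close> keeps track of the arcs a walk may use: walks confined to sets
  that share no arc and no mates concatenate to a regular walk.\<close>

definition rreach :: "'b set \<Rightarrow> 'a \<Rightarrow> 'a \<Rightarrow> bool" where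
  "rreach E u v \<longleftrightarrow> (\<exists>p. awalk u p v \<and> regular ma p \<and> set p \<subseteq> E)"

lemma rreach_in_verts:
  assumes "rreach E u v"
  shows "u \<in> verts G" "v \<in> verts G"
  using assms by (auto simp: rreach_def)

lemma rreach_refl: "u \<in> verts G \<Longrightarrow> rreach E u u"
  unfolding rreach_def by (rule exI[of _ "[]"]) (auto simp: awalk_Nil_iff regular_def)

lemma rreach_mono: "rreach E u v \<Longrightarrow> E \<subseteq> F \<Longrightarrow> rreach F u v"
  by (auto simp: rreach_def)

lemma rreach_arc: "e \<in> arcs G \<Longrightarrow> e \<in> E \<Longrightarrow> rreach E (tail G e) (head G e)"
  unfolding rreach_def
  by (rule exI[of _ "[e]"]) (auto simp: arc_implies_awalk regular_def dest: ma_neq)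

lemma rreach_mate:
  assumes "rreach E u v" "\<And>e. e \<in> E \<Longrightarrow> e \<in> arcs G \<Longrightarrow> ma e \<in> E"
  shows "rreach E (mv v) (mv u)"
proof -
  obtain p where "awalk u p v" "regular ma p" "set p \<subseteq> E" using assms by (auto simp: rreach_def)
  moreover from this have "set p \<subseteq> arcs G" by auto
  ultimately show ?thesis
    using assms(2) unfolding rreach_def
    by (intro exI[of _ "map ma (rev p)"]) (auto simp: awalk_mate regular_mate subset_iff)
qed

lemma awalk_regular_append:
  assumes "awalk u p v" "awalk v q w" "regular ma p" "regular ma q" "set p \<subseteq> E" "set q \<subseteq> F"
    and disj: "\<And>e. e \<in> E \<Longrightarrow> e \<notin> F \<and> ma e \<notin> F"
  shows "awalk u (p @ q) w" "regular ma (p @ q)"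
proof -
  show "awalk u (p @ q) w" using assms(1,2) by auto
  have "set q \<subseteq> arcs G" using assms(2) by auto
  then have "ma e \<notin> set p" if "e \<in> set q" for e
    using that assms(5,6) disj[of "ma e"] ma_ma[of e] by (metis subsetD)
  then show "regular ma (p @ q)"
    using assms(3-6) disj unfolding regular_def by fastforce
qed

lemma rreach_trans:
  assumes "rreach E u v" "rreach F v w" "\<And>e. e \<in> E \<Longrightarrow> e \<notin> F \<and> ma e \<notin> F"
  shows "rreach (E \<union> F) u w"
proof -
  obtain p q where "awalk u p v" "regular ma p" "set p \<subseteq> E" "awalk v q w" "regular ma q" "set q \<subseteq> F"
    using assms by (auto simp: rreach_def)
  then show ?thesis
    using awalk_regular_append[of u p v q w E F] assms(3) unfolding rreach_def
    by (intro exI[of _ "p @ q"]) auto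
qed

text \<open>The two walks form a regular closed walk, nonempty because \<open>u \<noteq> v\<close>.
  Apart from the exclusion of loops, this is how weak acyclicity enters the search for a
  bridge.\<close>

lemma rreach_closed:
  assumes "rreach E u v" "rreach F v u" "u \<noteq> v" "\<And>e. e \<in> E \<Longrightarrow> e \<notin> F \<and> ma e \<notin> F"
  shows "\<not> weakly_acyclic G ma"
proof -
  obtain p q where pq: "awalk u p v" "regular ma p" "set p \<subseteq> E" "awalk v q u" "regular ma q" "set q \<subseteq> F"
    using assms by (auto simp: rreach_def)
  moreover have "p \<noteq> []" using pq(1) assms(3) by (auto simp: awalk_Nil_iff)
  ultimately have "\<exists>q. cycle q \<and> regular ma q"
    using awalk_regular_append[of u p v q u E F] assms(4)
    by (intro regular_closed_imp_cycle[of u "p @ q"]) auto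
  then show ?thesis by (auto simp: weakly_acyclic_def)
qed

lemma weakly_acyclic_no_loop:
  assumes "weakly_acyclic G ma" "e \<in> arcs G"
  shows "head G e \<noteq> tail G e"
proof
  assume "head G e = tail G e"
  then have "awalk (tail G e) [e] (tail G e)" using assms(2) arc_implies_awalk by fastforce
  moreover have "regular ma [e]" using assms(2) ma_neq by (auto simp: regular_def)
  ultimately show False
    using regular_closed_imp_cycle[of "tail G e" "[e]"] assms(1) by (auto simp: weakly_acyclic_def)
qed

section \<open>Blossoms\<close>

definition inner :: "('a \<Rightarrow> 'l) \<Rightarrow> 'l \<Rightarrow> 'b set" where
  "inner c x = {e \<in> arcs G. c (tail G e) = x \<and> c (head G e) = x}"

text \<open>
  Excluding the arcs that leave the mate of the base (equivalently, enter the base) is what forces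
  some arc leaving \<open>mv b\<close> to exit the blossom, see \<open>blossom_exit\<close>.
\<close>

definition blossom :: "('a \<Rightarrow> 'l) \<Rightarrow> 'l \<Rightarrow> 'a \<Rightarrow> bool" where
  "blossom c x b \<longleftrightarrow> b \<in> verts G \<and> c b = x \<and>
     (\<forall>z\<in>verts G. c z = x \<longrightarrow>
        rreach {e \<in> inner c x. tail G e \<noteq> mv b \<and> head G e \<noteq> b} b z)"

text \<open>A partition is encoded by labels, its classes being the fibres of \<open>c\<close>, so
  that a merge is a relabelling. The two alternatives overlap: a pair of mates joined by an arc is a
  blossom.\<close>

definition blossom_colouring :: "('a \<Rightarrow> 'l) \<Rightarrow> bool" where
  "blossom_colouring c \<longleftrightarrow> (\<forall>v\<in>verts G. c (mv v) = c v \<and>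
     ({w \<in> verts G. c w = c v} = {v, mv v} \<or> (\<exists>b. blossom c (c v) b)))"

text \<open>Condition (ii) of a weak separator, with \<open>A = X\<close> and \<open>B\<close> its
  complement. It is applied to the subgraph that remains when \<open>Z\<close> and its mates are
  removed.\<close>

definition has_bridge :: bool where
  "has_bridge \<longleftrightarrow> (\<exists>X\<subseteq>verts G. self_symmetric mv X \<and> X \<noteq> {} \<and> X \<noteq> verts G \<and>
     (\<exists>a\<in>arcs G. connecting_arcs G X (verts G - X) = {a, ma a}))"

text \<open>
  A walk may enter the class of \<open>h\<close> at \<open>h\<close> and leave it at \<open>t\<close>. By the second
  clause, each node of the class can be reached by traversing either this walk or its mate, which
  enters at \<open>mv t\<close>.
\<close>

definition through :: "('a \<Rightarrow> 'l) \<Rightarrow> 'a \<Rightarrow> 'a \<Rightarrow> bool" where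
  "through c h t \<longleftrightarrow> rreach (inner c (c h)) h t \<and>
     (\<forall>z\<in>verts G. c z = c h \<longrightarrow>
        rreach (inner c (c h)) h z \<or> rreach (inner c (c h)) (mv t) z)"

lemma blossom_colouringD:
  assumes "blossom_colouring c" "v \<in> verts G"
  shows "c (mv v) = c v"
    "{w \<in> verts G. c w = c v} = {v, mv v} \<or> (\<exists>b. blossom c (c v) b)"
  using assms by (auto simp: blossom_colouring_def)

lemma inner_ma:
  assumes "blossom_colouring c" "e \<in> inner c x"
  shows "ma e \<in> inner c x"
  using assms blossom_colouringD(1)[OF assms(1)]
  by (auto simp: inner_def tail_ma head_ma ma_in_arcs)

lemma inner_rreach_mate:
  "blossom_colouring c \<Longrightarrow> rreach (inner c x) u v \<Longrightarrow> rreach (inner c x) (mv v) (mv u)"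
  by (auto intro: rreach_mate inner_ma)

lemma blossom_rreach:
  assumes "blossom c x b" "z \<in> verts G" "c z = x"
  shows "rreach (inner c x) b z"
  using assms by (auto simp: blossom_def intro: rreach_mono)

lemma blossom_rreach_mate:
  assumes "blossom_colouring c" "blossom c x b" "z \<in> verts G" "c z = x"
  shows "rreach (inner c x) z (mv b)"
  using inner_rreach_mate[OF assms(1) blossom_rreach[OF assms(2), of "mv z"]] assms(3,4)
  by (auto simp: mv_mv mv_in_verts blossom_colouringD[OF assms(1)])

text \<open>Makes it possible to run through a chain of classes backwards. Replacing
  \<open>h\<close> by \<open>mv t\<close> and \<open>t\<close> by \<open>mv h\<close> merely swaps
  the two alternatives in \<open>through\<close>; the last arc of the walk shows that both ends lie
  in one class.\<close>

lemma through_mate: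
  assumes "blossom_colouring c" "through c h t"
  shows "through c (mv t) (mv h)"
proof -
  have r: "rreach (inner c (c h)) h t" using assms(2) by (auto simp: through_def)
  then have v: "h \<in> verts G" "t \<in> verts G" by (auto dest: rreach_in_verts)
  have "c t = c h"
  proof -
    obtain p where p: "awalk h p t" "set p \<subseteq> inner c (c h)" using r by (auto simp: rreach_def)
    show ?thesis
    proof (cases p rule: rev_cases)
      case Nil then show ?thesis using p by (auto simp: awalk_Nil_iff)
    next
      case (snoc q e)
      then have "head G e = t" using p(1) by (auto simp: awalk_Cons_iff awalk_Nil_iff)
      then show ?thesis using p(2) snoc by (auto simp: inner_def)
    qed
  qed
  then have "c (mv t) = c h" using v blossom_colouringD(1)[OF assms(1)] by auto
  then show ?thesis
    using assms(2) inner_rreach_mate[OF assms(1) r] v mv_mv by (auto simp: through_def)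
qed

section \<open>Arcs that leave a class\<close>

context
  fixes c :: "'a \<Rightarrow> 'l"
  assumes wa: "weakly_acyclic G ma"
    and out: "\<And>v. v \<in> verts G \<Longrightarrow> \<exists>e\<in>arcs G. tail G e = v"
    and col: "blossom_colouring c"
begin

text \<open>If an arc \<open>e\<close> from \<open>mv b\<close> ended at a node \<open>w\<close> of
  the class, the mate of a walk from \<open>b\<close> to \<open>mv w\<close> would lead from
  \<open>w\<close> back to \<open>mv b\<close>, and \<open>e\<close> would close it.\<close>

lemma blossom_exit:
  assumes "blossom c x b"
  shows "\<exists>e\<in>arcs G. tail G e = mv b \<and> c (head G e) \<noteq> x"
proof (rule ccontr)
  assume neg: "\<not> ?thesis"
  have b: "b \<in> verts G" "c b = x" using assms by (auto simp: blossom_def)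
  obtain e where e: "e \<in> arcs G" "tail G e = mv b" using out b mv_in_verts by blast
  with neg have he: "c (head G e) = x" by auto
  define w where "w = head G e"
  have w: "w \<in> verts G" using e w_def by auto
  \<comment> \<open>This set is closed under mates and omits \<open>e\<close>, since
    \<open>e\<close> leaves \<open>mv b\<close>. So neither \<open>e\<close> nor its mate occurs on
    the walk that \<open>e\<close> closes.\<close>
  let ?F = "{e \<in> inner c x. tail G e \<noteq> mv b \<and> head G e \<noteq> b}"
  have F: "ma e \<in> ?F" if "e \<in> ?F" for e
  proof -
    have f: "e \<in> arcs G" "e \<in> inner c x" "tail G e \<noteq> mv b" "head G e \<noteq> b"
      using that by (auto simp: inner_def)
    then have "mv (head G e) \<noteq> mv b" "mv (tail G e) \<noteq> b"
      using b by (metis head_in_verts mv_mv, metis tail_in_verts mv_mv)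
    then show ?thesis using f inner_ma[OF col] by (simp add: tail_ma head_ma)
  qed
  have "rreach ?F b (mv w)"
    using assms w he mv_in_verts blossom_colouringD(1)[OF col w] w_def by (auto simp: blossom_def)
  then have "rreach ?F (mv (mv w)) (mv b)"
    using F by (intro rreach_mate) auto
  then have 1: "rreach ?F w (mv b)" using w mv_mv by simp
  have 2: "rreach {e} (mv b) w" using rreach_arc[of e "{e}"] e w_def by auto
  have "w \<noteq> mv b" using weakly_acyclic_no_loop[OF wa e(1)] e w_def by auto
  moreover have "f \<notin> {e} \<and> ma f \<notin> {e}" if "f \<in> ?F" for f
    using that F[OF that] e by auto
  ultimately show False using rreach_closed[OF 1 2] wa by blast
qed

text \<open>As there are no loops, an arc from \<open>v\<close> that stays in the pair ends at
  \<open>mv v\<close>, and then the pair is a blossom with base \<open>v\<close>.\<close>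

lemma trivial_exit:
  assumes "v \<in> verts G" "{w \<in> verts G. c w = c v} = {v, mv v}" "\<nexists>b. blossom c (c v) b"
  shows "\<exists>e\<in>arcs G. tail G e = v \<and> c (head G e) \<noteq> c v"
proof (rule ccontr)
  assume neg: "\<not> ?thesis"
  obtain e where e: "e \<in> arcs G" "tail G e = v" using out assms(1) by blast
  with neg have "c (head G e) = c v" by auto
  then have "head G e \<in> {v, mv v}" using e(1) head_in_verts unfolding assms(2)[symmetric] by simp
  with e weakly_acyclic_no_loop[OF wa e(1)] have h: "head G e = mv v" by simp
  let ?F = "{e \<in> inner c (c v). tail G e \<noteq> mv v \<and> head G e \<noteq> v}"
  have "e \<in> ?F"
    using e h mv_neq[OF assms(1)] blossom_colouringD(1)[OF col assms(1)] by (auto simp: inner_def)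
  then have "rreach ?F v (mv v)" using rreach_arc[of e ?F] e h by auto
  moreover have "rreach ?F v v" using assms(1) rreach_refl by blast
  moreover have "z \<in> {v, mv v}" if "z \<in> verts G" "c z = c v" for z
    using that unfolding assms(2)[symmetric] by simp
  ultimately have "blossom c (c v) v"
    using assms(1) unfolding blossom_def by auto
  then show False using assms(3) by blast
qed

lemma exists_crossing:
  assumes "v \<in> verts G"
  shows "\<exists>e\<in>arcs G. c (tail G e) \<noteq> c (head G e)"
proof (cases "\<exists>b. blossom c (c v) b")
  case True
  then obtain b where b: "blossom c (c v) b" by blast
  then have "c (mv b) = c v" using blossom_colouringD(1)[OF col] by (auto simp: blossom_def)
  then show ?thesis using blossom_exit[OF b] by metis
next
  case False
  then show ?thesis using trivial_exit[of v] blossom_colouringD(2)[OF col assms] assms by metis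
qed

text \<open>The exit depends on the class entered: a mere pair of mates is left at \<open>h\<close>
  itself, a blossom entered away from its base at \<open>mv b\<close>, and a blossom entered at its
  base at any node with another exit.\<close>

lemma next_crossing:
  assumes nb: "\<not> has_bridge" and a: "a \<in> arcs G" "c (tail G a) \<noteq> c (head G a)"
  shows "\<exists>e\<in>arcs G. c (tail G e) = c (head G a) \<and> c (head G e) \<noteq> c (tail G e) \<and> e \<noteq> ma a \<and>
    through c (head G a) (tail G e)"
proof -
  define h x where "h = head G a" and "x = c h"
  have h: "h \<in> verts G" "c h = x" "c (mv h) = x"
    using a blossom_colouringD(1)[OF col] by (auto simp: h_def x_def)
  have mh: "mv (mv h) = h" using h mv_mv by simp
  have tma: "tail G (ma a) = mv h" using a tail_ma h_def by simp
  show ?thesis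
  proof (cases "\<exists>b. blossom c x b")
    case False
    with blossom_colouringD(2)[OF col h(1)] h have tr: "{w \<in> verts G. c w = c h} = {h, mv h}" by auto
    then obtain e where e: "e \<in> arcs G" "tail G e = h" "c (head G e) \<noteq> c h"
      using trivial_exit[OF h(1)] False h by auto
    then have "e \<noteq> ma a" using tma mv_neq[OF h(1)] by auto
    moreover have "through c h h"
    proof -
      have "z \<in> {h, mv h}" if "z \<in> verts G" "c z = c h" for z
        using that unfolding tr[symmetric] by simp
      then show ?thesis
        unfolding through_def using rreach_refl[of h] rreach_refl[of "mv h"] h(1) mv_in_verts by auto
    qed
    ultimately show ?thesis using e by (intro bexI[of _ e]) (auto simp: h_def)
  next
    case True
    then obtain b where b: "blossom c x b" by blast
    then have bv: "b \<in> verts G" "c b = x" "c (mv b) = x"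
      using blossom_colouringD(1)[OF col] by (auto simp: blossom_def)
    show ?thesis
    proof (cases "h = b")
      case False
      obtain e where e: "e \<in> arcs G" "tail G e = mv b" "c (head G e) \<noteq> x"
        using blossom_exit[OF b] by blast
      then have "e \<noteq> ma a" using False tma mh mv_mv[OF bv(1)] by auto
      \<comment> \<open>Mates of walks from the base end at \<open>mv b\<close>, so \<open>h\<close>
        reaches \<open>mv b\<close>; the second clause holds since the mate of \<open>mv b\<close>
        is the base.\<close>
      moreover have "through c h (mv b)"
        unfolding through_def
        using blossom_rreach[OF b] blossom_rreach_mate[OF col b] h bv(1) mv_mv by auto
      ultimately show ?thesis using e bv h(2) by (intro bexI[of _ e]) (auto simp: h_def)
    next
      case True
      \<comment> \<open>The base reaches the whole class, so any exit will do. If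
        \<open>ma a\<close> were the only one, \<open>a\<close> would by symmetry be the only entry,
        and the class would yield a bridge.\<close>
      have "\<exists>e\<in>arcs G. c (tail G e) = x \<and> c (head G e) \<noteq> x \<and> e \<noteq> ma a"
      proof (rule ccontr)
        assume neg: "\<not> ?thesis"
        define X where "X = {w \<in> verts G. c w = x}"
        have cm: "c (mv v) = c v" if "v \<in> verts G" for v
          using that blossom_colouringD(1)[OF col] by blast
        have out1: "e = ma a" if "e \<in> arcs G" "tail G e \<in> X" "head G e \<notin> X" for e
          using that neg by (auto simp: X_def)
        have in1: "e = a" if "e \<in> arcs G" "tail G e \<notin> X" "head G e \<in> X" for e
        proof -
          have "ma e = ma a"
            using that by (intro out1) (auto simp: ma_in_arcs tail_ma head_ma X_def cm mv_in_verts)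
          then show ?thesis using ma_ma that(1) a(1) by metis
        qed
        have tX: "tail G a \<in> verts G - X" "mv (tail G a) \<in> verts G - X"
          using a cm[of "tail G a"] mv_in_verts[of "tail G a"] by (auto simp: X_def x_def h_def)
        have hX: "head G a \<in> X" "mv (head G a) \<in> X"
          using h mv_in_verts by (auto simp: X_def h_def)
        have "a \<in> connecting_arcs G X (verts G - X)" "ma a \<in> connecting_arcs G X (verts G - X)"
          using a(1) tX hX by (auto simp: connecting_arcs_def ma_in_arcs tail_ma head_ma)
        moreover have "e \<in> {a, ma a}" if "e \<in> connecting_arcs G X (verts G - X)" for e
          using that out1[of e] in1[of e] unfolding connecting_arcs_def by blast
        ultimately have "connecting_arcs G X (verts G - X) = {a, ma a}" by blast
        moreover have "self_symmetric mv X"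
          by (intro self_symmetricI) (auto simp: X_def cm mv_in_verts)
        moreover have "X \<subseteq> verts G" "X \<noteq> {}" "X \<noteq> verts G"
          using hX tX by (auto simp: X_def)
        ultimately have has_bridge using a(1) unfolding has_bridge_def by blast
        with nb show False by blast
      qed
      then obtain e where e: "e \<in> arcs G" "c (tail G e) = x" "c (head G e) \<noteq> x" "e \<noteq> ma a" by blast
      have "through c h (tail G e)"
        unfolding through_def using True blossom_rreach[OF b] h e by auto
      then show ?thesis using e h by (intro bexI[of _ e]) (auto simp: h_def)
    qed
  qed
qed

section \<open>Closed chains of colour classes\<close>

text \<open>The condition \<open>through\<close> concerns the classes \<open>f 1\<close> to
  \<open>f (k - 1)\<close> only: in \<open>f 0\<close> the chain starts and ends, possibly at nodes
  that no walk inside the class connects. For \<open>k = 2\<close> the condition on mates forbids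
  going back along the mate of \<open>a 0\<close>.\<close>

definition chain :: "(nat \<Rightarrow> 'b) \<Rightarrow> (nat \<Rightarrow> 'l) \<Rightarrow> nat \<Rightarrow> bool" where
  "chain a f k \<longleftrightarrow> 2 \<le> k \<and> inj_on f {..<k} \<and> f k = f 0 \<and>
     (\<forall>j<k. a j \<in> arcs G \<and> c (tail G (a j)) = f j \<and> c (head G (a j)) = f (Suc j)) \<and>
     (\<forall>j. Suc j < k \<longrightarrow> a (Suc j) \<noteq> ma (a j) \<and>
        through c (head G (a j)) (tail G (a (Suc j))))"

lemma colour_mv: "v \<in> verts G \<Longrightarrow> c (mv v) = c v"
  using blossom_colouringD(1)[OF col] .

text \<open>Crossings can be continued for ever, while there are finitely many classes. A shortest
  return to a class gives the chain.\<close>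

lemma chain_exists:
  assumes nb: "\<not> has_bridge" and ne: "verts G \<noteq> {}"
  shows "\<exists>a f k. chain a f k"
proof -
  let ?P = "\<lambda>e. e \<in> arcs G \<and> c (tail G e) \<noteq> c (head G e)"
  let ?Q = "\<lambda>a e. c (tail G e) = c (head G a) \<and> e \<noteq> ma a \<and> through c (head G a) (tail G e)"
  have "\<exists>s. \<forall>n::nat. ?P (s n) \<and> ?Q (s n) (s (Suc n))"
  proof (rule dependent_nat_choice)
    show "\<exists>e. ?P e" using ne exists_crossing by blast
    show "\<exists>e. ?P e \<and> ?Q a e" if "?P a" for a
      using next_crossing[OF nb, of a] that by metis
  qed
  then obtain s where P: "\<And>n. ?P (s n)" and Q: "\<And>n. ?Q (s n) (s (Suc n))" by blast
  define g where "g n = c (tail G (s n))" for n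
  have gS: "c (head G (s n)) = g (Suc n)" for n using Q[of n] by (simp add: g_def)
  have "range g \<subseteq> c ` verts G" using P by (auto simp: g_def)
  then have "finite (range g)" using finite_verts finite_subset by blast
  then have "\<not> inj g" using finite_imageD infinite_UNIV_nat by blast
  then obtain p q where "p \<noteq> q" "g p = g q" by (auto simp: inj_def)
  then obtain p q where pq: "p < q" "g p = g q" by (metis linorder_neqE_nat)
  \<comment> \<open>The minimum is taken over all starting points \<open>i\<close> at once, so
    labels at a smaller positive distance differ anywhere in the sequence.\<close>
  let ?R = "\<lambda>k. 0 < k \<and> (\<exists>i. g i = g (i + k))"
  have "?R (q - p)" using pq by (auto intro!: exI[of _ p])
  then have R: "?R (LEAST k. ?R k)" by (rule LeastI)
  define k where "k = (LEAST k. ?R k)"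
  from R obtain i where i: "0 < k" "g i = g (i + k)" by (auto simp: k_def)
  have min: "g m \<noteq> g (m + l)" if "0 < l" "l < k" for l m
    using not_less_Least[of l ?R] that k_def by blast
  have "g i \<noteq> g (Suc i)" using P[of i] gS[of i] by (simp add: g_def)
  then have "k \<noteq> 1" using i by auto
  moreover have "inj_on (\<lambda>j. g (i + j)) {..<k}"
  proof (rule linorder_inj_onI)
    fix x y assume "x < y" "x \<in> {..<k}" "y \<in> {..<k}"
    then show "g (i + x) \<noteq> g (i + y)" using min[of "y - x" "i + x"] by auto
  qed auto
  ultimately have "chain (\<lambda>j. s (i + j)) (\<lambda>j. g (i + j)) k"
    using i P Q gS by (auto simp: chain_def g_def[symmetric])
  then show ?thesis by blast
qed

lemma not_inner_ma: "e \<in> arcs G \<Longrightarrow> e \<notin> inner c x \<Longrightarrow> ma e \<notin> inner c x"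
  using inner_ma[OF col, of "ma e"] ma_ma by metis

section \<open>Walks along a chain\<close>

context
  fixes a f k
  assumes ch: "chain a f k"
begin

lemma chain_arc:
  assumes "j < k"
  shows "a j \<in> arcs G" "c (tail G (a j)) = f j" "c (head G (a j)) = f (Suc j)"
    "ma (a j) \<in> arcs G" "c (tail G (ma (a j))) = f (Suc j)" "c (head G (ma (a j))) = f j"
  using assms ch colour_mv by (auto simp: chain_def ma_in_arcs tail_ma head_ma)

lemma chain_k: "2 \<le> k" "f k = f 0"
  using ch by (auto simp: chain_def)

lemma chain_inj: "i < k \<Longrightarrow> j < k \<Longrightarrow> f i = f j \<longleftrightarrow> i = j"
  using ch by (auto simp: chain_def inj_on_def)

text \<open>The indices from 1 to \<open>k\<close> also name each class once, as \<open>k\<close>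
  stands in for 0.\<close>

lemma chain_inj_Suc: "i < k \<Longrightarrow> j < k \<Longrightarrow> f (Suc i) = f (Suc j) \<longleftrightarrow> i = j"
  using chain_inj[of "Suc i" "Suc j"] chain_inj[of "Suc i" 0] chain_inj[of 0 "Suc j"] chain_k
  by (cases "Suc i = k"; cases "Suc j = k") auto

lemma chain_crossing: "j < k \<Longrightarrow> f (Suc j) \<noteq> f j"
  using chain_inj[of "Suc j" j] chain_inj[of 0 j] chain_k by (cases "Suc j = k") auto

lemma chain_not_inner: "j < k \<Longrightarrow> a j \<notin> inner c x \<and> ma (a j) \<notin> inner c x"
  using chain_arc[of j] chain_crossing[of j] by (auto simp: inner_def)

lemma chain_step:
  assumes "Suc j < k"
  shows "a (Suc j) \<noteq> ma (a j)" "through c (head G (a j)) (tail G (a (Suc j)))"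
  using ch assms by (auto simp: chain_def)

lemma chain_through:
  assumes "Suc j < k"
  shows "rreach (inner c (f (Suc j))) (head G (a j)) (tail G (a (Suc j)))"
    "\<And>z. z \<in> verts G \<Longrightarrow> c z = f (Suc j) \<Longrightarrow>
       rreach (inner c (f (Suc j))) (head G (a j)) z \<or>
       rreach (inner c (f (Suc j))) (mv (tail G (a (Suc j)))) z"
  using chain_step(2)[OF assms] chain_arc(3)[of j] assms by (auto simp: through_def)

text \<open>Mates are included so that avoiding this set means avoiding mates as well. The arcs
  inside \<open>f 0\<close> are left out: they remain available for closing the walk or for
  prefixing a walk from a base.\<close>

definition traversed :: "nat \<Rightarrow> 'b set" where
  "traversed n = (\<Union>j\<in>{..<n}. {a j, ma (a j)}) \<union> (\<Union>j\<in>{0<..<n}. inner c (f j))"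

lemma traversed_Suc:
  "traversed (Suc n) =
     traversed n \<union> {a n, ma (a n)} \<union> (if n = 0 then {} else inner c (f n))"
  by (auto simp: traversed_def less_Suc_eq)

lemma traversed_arcs: "n \<le> k \<Longrightarrow> traversed n \<subseteq> arcs G"
  using chain_arc by (auto simp: traversed_def inner_def)

lemma traversed_inner:
  assumes "n \<le> k" "x = f 0 \<or> (\<exists>m\<ge>n. m < k \<and> x = f m)" "e \<in> traversed n"
  shows "e \<notin> inner c x \<and> ma e \<notin> inner c x"
proof -
  have e: "e \<in> arcs G" using traversed_arcs assms by auto
  have "e \<notin> inner c x"
  proof (cases "\<exists>j<n. e = a j \<or> e = ma (a j)")
    case True
    then show ?thesis using chain_not_inner assms(1) by auto
  next
    case False
    then obtain j where j: "0 < j" "j < n" "e \<in> inner c (f j)"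
      using assms(3) by (auto simp: traversed_def)
    have "f j \<noteq> x"
      using assms(2)
    proof (elim disjE exE conjE)
      assume "x = f 0"
      then show ?thesis using chain_inj[of j 0] j assms(1) by auto
    next
      fix m assume "n \<le> m" "m < k" "x = f m"
      then show ?thesis using chain_inj[of j m] j by auto
    qed
    then show ?thesis using j by (auto simp: inner_def)
  qed
  then show ?thesis using e not_inner_ma by blast
qed

text \<open>The class of the tail identifies an arc of the chain or the mate of one. The one
  coincidence this leaves open, \<open>ma (a n) = a (Suc n)\<close>, is excluded by
  \<open>chain\<close>.\<close>

lemma chain_arc_fresh:
  assumes "Suc n < k" "e \<in> traversed (Suc n) \<union> inner c (f (Suc n))"
  shows "e \<notin> {a (Suc n), ma (a (Suc n))} \<and> ma e \<notin> {a (Suc n), ma (a (Suc n))}"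
proof -
  have e: "e \<in> arcs G" using traversed_arcs[of "Suc n"] assms by (auto simp: inner_def)
  have ndiff: "a j \<noteq> a (Suc n) \<and> a j \<noteq> ma (a (Suc n)) \<and> ma (a j) \<noteq> a (Suc n) \<and>
      ma (a j) \<noteq> ma (a (Suc n))" if "j \<le> n" for j
  proof -
    have 1: "a j \<noteq> a (Suc n)"
      using chain_arc(2)[of j] chain_arc(2)[of "Suc n"] chain_inj[of j "Suc n"] that assms(1) by auto
    have 2: "ma (a j) \<noteq> a (Suc n)"
    proof
      assume *: "ma (a j) = a (Suc n)"
      then have "f (Suc j) = f (Suc n)"
        using chain_arc(5)[of j] chain_arc(2)[of "Suc n"] that assms(1) by auto
      then have "j = n" using chain_inj_Suc[of j n] that assms(1) by auto
      then show False using * chain_step(1)[OF assms(1)] by auto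
    qed
    show ?thesis
      using 1 2 ma_ma[of "a j"] ma_ma[of "a (Suc n)"] chain_arc(1)[of j] chain_arc(1)[of "Suc n"]
        that assms(1) by (metis Suc_lessD le_less_trans)
  qed
  have "e \<notin> {a (Suc n), ma (a (Suc n))}"
  proof (cases "\<exists>j\<le>n. e = a j \<or> e = ma (a j)")
    case True
    then show ?thesis using ndiff by auto
  next
    case False
    then have "\<exists>x. e \<in> inner c x" using assms(2) by (auto simp: traversed_def less_Suc_eq_le)
    then show ?thesis using chain_not_inner[OF assms(1)] by auto
  qed
  then show ?thesis using e ma_ma chain_arc(1)[OF assms(1)] by (metis insertCI insertE singletonD)
qed

lemma chain_extend:
  assumes "Suc n < k" "rreach (traversed (Suc n)) u (head G (a n))"
    "rreach (inner c (f (Suc n))) (head G (a n)) z"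
  shows "rreach (traversed (Suc n) \<union> inner c (f (Suc n))) u z"
  using assms traversed_inner[of "Suc n" "f (Suc n)"] by (intro rreach_trans) auto

lemma chain_arc_rreach: "n < k \<Longrightarrow> rreach {a n, ma (a n)} (tail G (a n)) (head G (a n))"
  using chain_arc(1) by (intro rreach_arc) auto

lemma chain_rreach:
  "n < k \<Longrightarrow> rreach (traversed (Suc n)) (tail G (a 0)) (head G (a n))"
proof (induction n)
  case 0
  then show ?case by (intro rreach_mono[OF chain_arc_rreach]) (auto simp: traversed_def)
next
  case (Suc n)
  then have "rreach (traversed (Suc n) \<union> inner c (f (Suc n))) (tail G (a 0)) (tail G (a (Suc n)))"
    using chain_extend chain_through(1) by simp
  from rreach_trans[OF this chain_arc_rreach[OF Suc.prems]] chain_arc_fresh[OF Suc.prems]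
  have "rreach (traversed (Suc n) \<union> inner c (f (Suc n)) \<union> {a (Suc n), ma (a (Suc n))})
      (tail G (a 0)) (head G (a (Suc n)))" by blast
  then show ?case by (rule rreach_mono) (auto simp: traversed_Suc[of "Suc n"])
qed

text \<open>Such a walk would close the chain to a regular closed walk. The closed walk is cut
  before its last chain arc, because the two cut points then lie in different classes and are
  distinct.\<close>

lemma chain_not_closed: "\<not> rreach (inner c (f 0)) (head G (a (k - 1))) (tail G (a 0))"
proof
  assume r: "rreach (inner c (f 0)) (head G (a (k - 1))) (tail G (a 0))"
  define m where "m = k - 2"
  have m: "Suc m < k" "k - 1 = Suc m" using chain_k by (auto simp: m_def)
  let ?D = "traversed (Suc m) \<union> inner c (f (Suc m))" and ?A = "{a (Suc m), ma (a (Suc m))}"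
  have 1: "rreach ?D (tail G (a 0)) (tail G (a (Suc m)))"
    using chain_extend[OF m(1) _ chain_through(1)[OF m(1)]] chain_rreach[of m] m by simp
  have 2: "rreach (?A \<union> inner c (f 0)) (tail G (a (Suc m))) (tail G (a 0))"
    using r m(2) chain_not_inner[OF m(1)] ma_ma[OF chain_arc(1)[OF m(1)]]
    by (intro rreach_trans[OF chain_arc_rreach[OF m(1)]]) auto
  have "tail G (a 0) \<noteq> tail G (a (Suc m))"
    using chain_arc(2)[of 0] chain_arc(2)[OF m(1)] chain_inj[of 0 "Suc m"] m(1) by auto
  moreover have "e \<notin> ?A \<union> inner c (f 0) \<and> ma e \<notin> ?A \<union> inner c (f 0)" if e: "e \<in> ?D" for e
  proof -
    have "e \<notin> inner c (f 0) \<and> ma e \<notin> inner c (f 0)"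
    proof (cases "e \<in> traversed (Suc m)")
      case True
      then show ?thesis using traversed_inner[of "Suc m" "f 0" e] m(1) by auto
    next
      case False
      then have "e \<in> inner c (f (Suc m))" using e by auto
      moreover have "f (Suc m) \<noteq> f 0" using chain_inj[of "Suc m" 0] m(1) by auto
      ultimately have "e \<in> arcs G" "e \<notin> inner c (f 0)" by (auto simp: inner_def)
      then show ?thesis using not_inner_ma by blast
    qed
    then show ?thesis using chain_arc_fresh[OF m(1) e] by blast
  qed
  ultimately show False using rreach_closed[OF 1 2] wa by blast
qed

text \<open>
  This set is the same for a chain and for its mate traversed backwards (\<open>outer_mate\<close>), so that
  walks along either of them can be treated alike.
\<close>

definition outer :: "'b set" where
  "outer = {e \<in> arcs G. c (tail G e) \<in> f ` {..<k} \<and> c (head G e) \<in> f ` {..<k} \<and>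
     (c (tail G e) = f 0 \<longrightarrow>
        c (head G e) \<noteq> f 0 \<and> tail G e \<in> {tail G (a 0), mv (head G (a (k - 1)))}) \<and>
     (c (head G e) = f 0 \<longrightarrow> head G e \<in> {head G (a (k - 1)), mv (tail G (a 0))})}"

lemma chain_colour_mem: "j \<le> k \<Longrightarrow> f j \<in> f ` {..<k}"
  using chain_k by (cases "j = k") auto

text \<open>Only \<open>a 0\<close>, \<open>a (k - 1)\<close> and their mates have an end in the
  class \<open>f 0\<close>.\<close>

lemma traversed_outer: "traversed k \<subseteq> outer"
proof
  fix e assume e: "e \<in> traversed k"
  consider j where "j < k" "e \<in> {a j, ma (a j)}" | j where "0 < j" "j < k" "e \<in> inner c (f j)"
    using e by (auto simp: traversed_def)
  then show "e \<in> outer"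
  proof cases
    case 1
    have j: "Suc j = k \<longleftrightarrow> j = k - 1" using 1 by auto
    have *: "f j = f 0 \<longleftrightarrow> j = 0" "f (Suc j) = f 0 \<longleftrightarrow> j = k - 1"
      using chain_inj[of j 0] chain_inj_Suc[of j "k - 1"] 1 chain_k by auto
    then show ?thesis
      using 1 chain_arc[of j] chain_colour_mem[of j] chain_colour_mem[of "Suc j"] chain_k
      unfolding outer_def by (auto simp: tail_ma head_ma)
  next
    case 2
    then have "f j \<noteq> f 0" using chain_inj[of j 0] by auto
    then show ?thesis using 2 unfolding outer_def by (auto simp: inner_def)
  qed
qed

lemma chain_forward:
  assumes "Suc n < k" "rreach (inner c (f (Suc n))) (head G (a n)) z"
  shows "rreach outer (tail G (a 0)) z"
proof -
  have "rreach (traversed (Suc n) \<union> inner c (f (Suc n))) (tail G (a 0)) z"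
    using chain_extend chain_rreach assms by simp
  moreover have "traversed (Suc n) \<union> inner c (f (Suc n)) \<subseteq> traversed k"
  proof -
    have "traversed (Suc n) \<subseteq> traversed k"
      unfolding traversed_def using assms(1) by (intro Un_mono UN_mono) auto
    moreover have "inner c (f (Suc n)) \<subseteq> traversed k" using assms(1) by (auto simp: traversed_def)
    ultimately show ?thesis by blast
  qed
  ultimately show ?thesis using traversed_outer rreach_mono by blast
qed

end

text \<open>The mate of \<open>a (k - 1 - j)\<close> leads from \<open>f (k - j)\<close> to
  \<open>f (k - 1 - j)\<close>. Since \<open>f k = f 0\<close>, the reversed chain starts in the
  same class.\<close>

lemma chain_mate:
  assumes ch: "chain a f k"
  shows "chain (\<lambda>j. ma (a (k - 1 - j))) (\<lambda>j. f (k - j)) k"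
  unfolding chain_def
proof (intro conjI allI impI)
  show "inj_on (\<lambda>j. f (k - j)) {..<k}"
  proof (rule inj_onI)
    fix i j assume "i \<in> {..<k}" "j \<in> {..<k}" "f (k - i) = f (k - j)"
    then show "i = j" using chain_inj_Suc[OF ch, of "k - 1 - i" "k - 1 - j"]
      by (auto simp: Suc_diff_Suc)
  qed
  show "2 \<le> k" "f (k - k) = f (k - 0)" using chain_k[OF ch] by auto
next
  fix j assume j: "j < k"
  define i where "i = k - 1 - j"
  have "i < k" "k - j = Suc i" "k - Suc j = i" using j by (auto simp: i_def)
  then show "ma (a (k - 1 - j)) \<in> arcs G" "c (tail G (ma (a (k - 1 - j)))) = f (k - j)"
    "c (head G (ma (a (k - 1 - j)))) = f (k - Suc j)"
    using chain_arc(4-6)[OF ch, of i] by (simp_all add: i_def[symmetric])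
next
  fix j assume j: "Suc j < k"
  define i where "i = k - 1 - Suc j"
  have i: "Suc i < k" "k - 1 - j = Suc i" "k - 1 - Suc j = i" using j by (auto simp: i_def)
  have ar: "a i \<in> arcs G" "a (Suc i) \<in> arcs G" using chain_arc(1)[OF ch] i by auto
  have "ma (a i) \<noteq> ma (ma (a (Suc i)))"
    using chain_step(1)[OF ch i(1)] ma_ma ar by metis
  then show "ma (a (k - 1 - Suc j)) \<noteq> ma (ma (a (k - 1 - j)))" using i by (simp add: i_def)
  show "through c (head G (ma (a (k - 1 - j)))) (tail G (ma (a (k - 1 - Suc j))))"
    using through_mate[OF col chain_step(2)[OF ch i(1)]] ar
    unfolding i(2,3) by (simp add: head_ma tail_ma)
qed

lemma outer_mate:
  assumes ch: "chain a f k"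
  shows "outer (\<lambda>j. ma (a (k - 1 - j))) (\<lambda>j. f (k - j)) k = outer a f k"
proof -
  have k: "0 < k" "f k = f 0" using chain_k[OF ch] by auto
  have ar: "a 0 \<in> arcs G" "a (k - 1) \<in> arcs G" using chain_arc(1)[OF ch] k by auto
  have "(\<lambda>j. f (k - j)) ` {..<k} = f ` {..<k}"
  proof (intro equalityI subsetI)
    fix x assume "x \<in> (\<lambda>j. f (k - j)) ` {..<k}"
    then show "x \<in> f ` {..<k}" using chain_colour_mem[OF ch] by auto
  next
    fix x assume "x \<in> f ` {..<k}"
    then obtain j where "j < k" "x = f j" by auto
    then show "x \<in> (\<lambda>j. f (k - j)) ` {..<k}"
      using k by (cases "j = 0") (auto intro: image_eqI[of _ _ "k - j"] image_eqI[of _ _ 0])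
  qed
  then show ?thesis
    unfolding outer_def[OF ch] outer_def[OF chain_mate[OF ch]]
    using ar k by (auto simp: tail_ma head_ma mv_mv)
qed

text \<open>By \<open>through\<close>, \<open>z\<close> is reached either from the point where the
  chain enters its class or from the mate of the point where the chain leaves it, which is where the
  reversed chain enters.\<close>

lemma chain_cover:
  assumes ch: "chain a f k" and z: "z \<in> verts G" "c z \<in> f ` {..<k}" "c z \<noteq> f 0"
  shows "rreach (outer a f k) (tail G (a 0)) z \<or>
    rreach (outer a f k) (mv (head G (a (k - 1)))) z"
proof -
  obtain j where "j < k" "c z = f j" using z by auto
  then obtain n where n: "Suc n < k" "c z = f (Suc n)" using z(3) by (cases j) auto
  from chain_through(2)[OF ch n(1) z(1) n(2)] show ?thesis
  proof
    assume "rreach (inner c (f (Suc n))) (head G (a n)) z"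
    then show ?thesis using chain_forward[OF ch n(1)] by blast
  next
    assume r: "rreach (inner c (f (Suc n))) (mv (tail G (a (Suc n)))) z"
    \<comment> \<open>Arc number \<open>m\<close> of the reversed chain is the mate of
      \<open>a (Suc n)\<close> and enters the class of \<open>z\<close>.\<close>
    define m where "m = k - 1 - Suc n"
    have m: "Suc m < k" "k - Suc m = Suc n" "k - 1 - m = Suc n" using n by (auto simp: m_def)
    have ar: "a (Suc n) \<in> arcs G" "a (k - 1) \<in> arcs G" using chain_arc(1)[OF ch] n by auto
    have "rreach (outer a f k) (tail G (ma (a (k - 1 - 0)))) z"
      using chain_forward[OF chain_mate[OF ch] m(1), of z] r outer_mate[OF ch] m(2,3) ar
      by (simp add: head_ma)
    then show ?thesis using ar by (simp add: tail_ma)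
  qed
qed

text \<open>
  If the class \<open>f 0\<close> is a blossom, its base remains the base of the merged class; if it is a pair
  of mates, the new base is the node where the chain starts.
\<close>

lemma merge_blossom:
  assumes ch: "chain a f k"
  defines "c' \<equiv> \<lambda>v. if c v \<in> f ` {..<k} then f 0 else c v"
  shows "\<exists>b. blossom c' (f 0) b"
proof -
  define u y where "u = tail G (a 0)" and "y = head G (a (k - 1))"
  have k: "0 < k" "f k = f 0" "k - 1 < k" "Suc (k - 1) = k" using chain_k[OF ch] by auto
  have u: "u \<in> verts G" "c u = f 0" using chain_arc[OF ch k(1)] by (auto simp: u_def)
  have y: "y \<in> verts G" "c y = f 0" using chain_arc[OF ch k(3)] k by (auto simp: y_def)
  have nc: "\<not> rreach (inner c (f 0)) y u" using chain_not_closed[OF ch] by (simp add: u_def y_def)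
  have c'0: "c' v = f 0 \<longleftrightarrow> c v \<in> f ` {..<k}" for v
    using k by (auto simp: c'_def)
  have f0: "f 0 \<in> f ` {..<k}" using k by auto
  have outer: "e \<in> arcs G" "c' (tail G e) = f 0" "c' (head G e) = f 0"
    "c (tail G e) = f 0 \<Longrightarrow> c (head G e) \<noteq> f 0 \<and> tail G e \<in> {u, mv y}"
    "c (head G e) = f 0 \<Longrightarrow> head G e \<in> {y, mv u}"
    if "e \<in> outer a f k" for e
    using that c'0 unfolding outer_def[OF ch] u_def y_def by auto
  have sub: "inner c (f 0) \<subseteq> inner c' (f 0)" using f0 by (auto simp: inner_def c'0)
  let ?E = "\<lambda>b. {e \<in> inner c' (f 0). tail G e \<noteq> mv b \<and> head G e \<noteq> b}"
  have outer_sub: "outer a f k \<subseteq> ?E b"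
    if b: "b \<in> verts G" "c b = f 0" "u \<noteq> mv b" "y \<noteq> b" for b
  proof
    fix e assume e: "e \<in> outer a f k"
    have "mv y \<noteq> mv b" "mv u \<noteq> b" using b u y mv_mv by metis+
    moreover have "c (mv b) = f 0" using b colour_mv by simp
    ultimately have "tail G e \<noteq> mv b" "head G e \<noteq> b"
      using outer(4,5)[OF e] b by auto
    then show "e \<in> ?E b" using outer(1-3)[OF e] by (simp add: inner_def)
  qed
  have cover: "rreach (outer a f k) u z \<or> rreach (outer a f k) (mv y) z"
    if "z \<in> verts G" "c' z = f 0" "c z \<noteq> f 0" for z
    using chain_cover[OF ch] that by (simp add: c'0 u_def y_def)
  show ?thesis
  proof (cases "\<exists>b. blossom c (f 0) b")
    case True
    then obtain b where b: "blossom c (f 0) b" by blast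
    have bv: "b \<in> verts G" "c b = f 0" using b by (auto simp: blossom_def)
    \<comment> \<open>A chain ending at \<open>b\<close> or starting at \<open>mv b\<close> could be
      closed inside the class. Hence walks along the chain or its mate use none of the arcs
      forbidden for base \<open>b\<close>.\<close>
    have yb: "y \<noteq> b" using nc blossom_rreach[OF b u] by blast
    have ub: "u \<noteq> mv b" using nc blossom_rreach_mate[OF col b y] by blast
    let ?I = "{e \<in> inner c (f 0). tail G e \<noteq> mv b \<and> head G e \<noteq> b}"
    have I: "rreach ?I b z" if "z \<in> verts G" "c z = f 0" for z
      using b that by (auto simp: blossom_def)
    have I_sub: "?I \<subseteq> ?E b" using sub by auto
    have disj: "e \<notin> outer a f k \<and> ma e \<notin> outer a f k" if "e \<in> ?I" for e
    proof -
      have "e \<in> inner c (f 0)" "ma e \<in> inner c (f 0)" using that inner_ma[OF col] by auto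
      then show ?thesis using outer(4) by (auto simp: inner_def)
    qed
    have ext: "rreach (?E b) b z" if "rreach (outer a f k) w z" "w \<in> verts G" "c w = f 0" for w z
      by (rule rreach_mono[OF rreach_trans[OF I[OF that(2,3)] that(1) disj]])
        (use I_sub outer_sub[OF bv ub yb] in auto)
    have "rreach (?E b) b z" if z: "z \<in> verts G" "c' z = f 0" for z
    proof (cases "c z = f 0")
      case True
      then show ?thesis using I[OF z(1)] I_sub rreach_mono by blast
    next
      case False
      then show ?thesis
        using cover[OF z] ext[of u z] ext[of "mv y" z] u y mv_in_verts[of y] colour_mv[of y] by argo
    qed
    moreover have "c' b = f 0" using bv f0 by (simp add: c'0)
    ultimately show ?thesis using bv unfolding blossom_def by blast
  next
    case False
    have part: "z \<in> {u, mv u}" if "z \<in> verts G" "c z = f 0" for z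
      using blossom_colouringD(2)[OF col u(1)] False that u by auto
    have "y \<noteq> u" using nc rreach_refl[OF u(1)] by metis
    \<comment> \<open>The chain ends at the mate of its start, so the chain and its reversal both
      start at \<open>u\<close>, and the full chain reaches the other node of the pair.\<close>
    then have yu: "y = mv u" using part[OF y] by auto
    then have myu: "mv y = u" using u mv_mv by simp
    have sub': "outer a f k \<subseteq> ?E u"
      using outer_sub[OF u] \<open>y \<noteq> u\<close> mv_neq[OF u(1)] by metis
    have "rreach (outer a f k) u y"
      using chain_rreach[OF ch k(3)] traversed_outer[OF ch] unfolding k(4) u_def y_def
      by (rule rreach_mono)
    then have "rreach (outer a f k) u z" if "z \<in> verts G" "c' z = f 0" for z
      using that cover[OF that] part[of z] rreach_refl[OF u(1)] yu myu by (cases "c z = f 0") auto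
    then have "rreach (?E u) u z" if "z \<in> verts G" "c' z = f 0" for z
      using that sub' rreach_mono by blast
    moreover have "c' u = f 0" using u f0 by (simp add: c'0)
    ultimately show ?thesis using u unfolding blossom_def by blast
  qed
qed

text \<open>Classes off the chain keep their labels and inner arcs. The label
  \<open>f (Suc 0)\<close> disappears, so the number of classes drops.\<close>

lemma merge_colouring:
  assumes ch: "chain a f k"
  shows "\<exists>c' :: 'a \<Rightarrow> 'l. blossom_colouring c' \<and> card (c' ` verts G) < card (c ` verts G)"
proof -
  define c' where "c' = (\<lambda>v. if c v \<in> f ` {..<k} then f 0 else c v)"
  have bl: "\<exists>b. blossom c' (f 0) b" using merge_blossom[OF ch] by (simp add: c'_def)
  have k: "0 < k" "Suc 0 < k" using chain_k[OF ch] by auto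
  have f0: "f 0 \<in> f ` {..<k}" using k by auto
  have "{w \<in> verts G. c' w = c' v} = {v, mv v} \<or> (\<exists>b. blossom c' (c' v) b)" if v: "v \<in> verts G" for v
  proof (cases "c v \<in> f ` {..<k}")
    case True
    then show ?thesis using bl by (simp add: c'_def)
  next
    case False
    then have eq: "c' w = c v \<longleftrightarrow> c w = c v" for w using f0 by (auto simp: c'_def)
    then have "inner c' (c v) = inner c (c v)" by (simp add: inner_def)
    then have "blossom c' (c v) b \<longleftrightarrow> blossom c (c v) b" for b by (simp add: blossom_def eq)
    moreover have cv: "c' v = c v" by (simp add: eq)
    ultimately show ?thesis using blossom_colouringD(2)[OF col v] unfolding cv by (simp add: eq)
  qed
  then have bc: "blossom_colouring c'"
    using colour_mv by (simp add: blossom_colouring_def c'_def)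
  have "c' ` verts G \<subset> c ` verts G"
  proof -
    have "f 0 \<in> c ` verts G" "f (Suc 0) \<in> c ` verts G"
      using chain_arc[OF ch k(1)] by (auto simp: image_iff) (metis tail_in_verts, metis head_in_verts)
    moreover have "f (Suc 0) \<notin> c' ` verts G"
    proof -
      have "f (Suc 0) \<in> f ` {..<k}" using k(2) by blast
      then show ?thesis using chain_crossing[OF ch k(1)] by (auto simp: c'_def)
    qed
    moreover have "c' v \<in> c ` verts G" if "v \<in> verts G" for v
      using that \<open>f 0 \<in> c ` verts G\<close> by (simp add: c'_def)
    ultimately show ?thesis by blast
  qed
  then have lt: "card (c' ` verts G) < card (c ` verts G)"
    by (intro psubset_card_mono) auto
  show ?thesis using bc lt by blast
qed

end

text \<open>Starting from the partition into pairs of mates, each merge made for lack of a bridge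
  lowers the number of classes, which cannot go on for ever.\<close>

lemma weakly_acyclic_has_bridge:
  assumes wa: "weakly_acyclic G ma" and ne: "verts G \<noteq> {}"
    and out: "\<And>v. v \<in> verts G \<Longrightarrow> \<exists>e\<in>arcs G. tail G e = v"
  shows has_bridge
proof -
  have "has_bridge" if "blossom_colouring c" for c :: "'a \<Rightarrow> 'a set"
    using that
  proof (induction "card (c ` verts G)" arbitrary: c rule: less_induct)
    case less
    then show ?case
      using chain_exists[OF wa out less.prems _ ne] merge_colouring[OF wa out less.prems] by blast
  qed
  moreover have "blossom_colouring (\<lambda>v. {v, mv v})"
    unfolding blossom_colouring_def
  proof (intro ballI conjI disjI1)
    fix v assume v: "v \<in> verts G"
    show "{mv v, mv (mv v)} = {v, mv v}" using v mv_mv by auto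
    show "{w \<in> verts G. {w, mv w} = {v, mv v}} = {v, mv v}"
      using v mv_mv mv_in_verts by (auto simp: doubleton_eq_iff)
  qed
  ultimately show ?thesis by blast
qed

section \<open>Weak separators\<close>

lemma closed_awalk_ends:
  assumes "awalk u p u"
  shows "head G ` set p = tail G ` set p"
proof (cases "p = []")
  case False
  \<comment> \<open>Invariant of open walks. In a nonempty closed walk the added node already
    belongs to both sets.\<close>
  have "cas x q w \<Longrightarrow> insert x (head G ` set q) = insert w (tail G ` set q)" for x q w
    by (induction x q w rule: cas.induct) auto
  from this[of u p u] have ins: "insert u (head G ` set p) = insert u (tail G ` set p)"
    using assms by (auto simp: awalk_def)
  have "u \<in> tail G ` set p" using assms False by (cases p) (auto simp: awalk_Cons_iff)
  moreover have "u \<in> head G ` set p"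
    using assms False by (cases p rule: rev_cases) (auto simp: awalk_Cons_iff awalk_Nil_iff)
  ultimately show ?thesis using ins by (simp add: insert_absorb)
qed simp

lemma awalk_leaves:
  "awalk u p v \<Longrightarrow> u \<in> P \<Longrightarrow> v \<notin> P \<Longrightarrow> \<exists>e\<in>set p. tail G e \<in> P \<and> head G e \<notin> P"
  by (induction p arbitrary: u) (auto simp: awalk_Nil_iff awalk_Cons_iff)

text \<open>The stretch from \<open>u\<close> to \<open>e2\<close> leaves \<open>P\<close> if
  \<open>u\<close> lies in \<open>P\<close>; otherwise the stretch from \<open>e1\<close> to the end
  does.\<close>

lemma closed_awalk_leaves:
  assumes p: "awalk u p u" and e: "e1 \<in> set p" "tail G e1 \<in> P" "e2 \<in> set p" "tail G e2 \<notin> P"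
  shows "\<exists>e\<in>set p. tail G e \<in> P \<and> head G e \<notin> P"
proof (cases "u \<in> P")
  case True
  obtain q r where "p = q @ e2 # r" using e(3) by (meson split_list)
  then have "awalk u q (tail G e2)" "set q \<subseteq> set p" using p by (auto simp: awalk_Cons_iff)
  then show ?thesis using awalk_leaves[of u q _ P] True e(4) by blast
next
  case False
  obtain q r where "p = q @ e1 # r" using e(1) by (meson split_list)
  then have "awalk (tail G e1) (e1 # r) u" "set (e1 # r) \<subseteq> set p"
    using p by (auto simp: awalk_Cons_iff)
  then show ?thesis using awalk_leaves[of _ "e1 # r" u P] False e(2) by blast
qed

section \<open>Passage to induced subgraphs\<close>

lemma awalk_induce_arcs:
  assumes "awalk u p v" "p \<noteq> []" "\<And>e. e \<in> set p \<Longrightarrow> tail G e \<in> X \<and> head G e \<in> X"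
  shows "pre_digraph.awalk (G \<restriction> X) u p v"
  using assms by (intro awalk_induce) (auto simp: set_awalk_verts_not_Nil)

lemma weakly_acyclic_induce:
  assumes "weakly_acyclic G ma" "X \<subseteq> verts G"
  shows "weakly_acyclic (G \<restriction> X) ma"
  using assms subgraph_cycle[OF subgraph_induce_subgraphI] by (auto simp: weakly_acyclic_def)

lemma skew_symmetric_graph_induce:
  assumes "X \<subseteq> verts G" "\<And>v. v \<in> X \<Longrightarrow> mv v \<in> X"
  shows "skew_symmetric_graph (G \<restriction> X) mv ma"
proof -
  interpret H: wf_digraph "G \<restriction> X" by auto
  show ?thesis
    using assms by unfold_locales
      (auto simp: mv_mv mv_neq ma_in_arcs ma_ma ma_neq tail_ma head_ma finite_subset)
qed

lemma weak_separator_exists: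
  assumes wa: "weakly_acyclic G ma" and ns: "\<not> strongly_acyclic G"
  shows "\<exists>A B Z. weak_separator G mv ma A B Z"
proof -
  obtain u p where p: "awalk u p u" "p \<noteq> []"
    using ns by (auto simp: strongly_acyclic_def closed_w_def)
  define T where "T = tail G ` set p"
  have hT: "T = head G ` set p" using closed_awalk_ends[OF p(1)] by (simp add: T_def)
  have pa: "set p \<subseteq> arcs G" using p by auto
  define U where "U = T \<union> mv ` T"
  have TV: "T \<subseteq> verts G" using pa by (auto simp: T_def)
  have U: "U \<subseteq> verts G" "U \<noteq> {}" "\<And>v. v \<in> U \<Longrightarrow> mv v \<in> U"
    using TV p(2) mv_in_verts mv_mv by (auto simp: U_def T_def subset_iff)
  \<comment> \<open>Ensures later that a node without an outgoing arc inside \<open>S\<close> is not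
    in \<open>U\<close>, so that it may be added to \<open>Z\<close>.\<close>
  have Uout: "\<exists>e\<in>arcs G. tail G e = v \<and> head G e \<in> U" if vU: "v \<in> U" for v
  proof (cases "v \<in> T")
    case True
    then obtain e where "e \<in> set p" "tail G e = v" by (auto simp: T_def)
    moreover from this have "head G e \<in> U" by (auto simp: U_def hT)
    ultimately show ?thesis using pa by auto
  next
    case False
    then obtain e where e: "e \<in> set p" "v = mv (head G e)" using vU by (auto simp: U_def hT)
    then have "mv (tail G e) \<in> U" by (auto simp: U_def T_def)
    then show ?thesis using e pa by (intro bexI[of _ "ma e"]) (auto simp: tail_ma head_ma ma_in_arcs)
  qed
  define F where "F = {Z. Z \<subseteq> verts G \<and> Z \<inter> mv ` Z = {} \<and> Z \<inter> U = {} \<and>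
    (\<forall>e\<in>arcs G. tail G e \<in> Z \<longrightarrow> head G e \<in> Z)}"
  have "F \<subseteq> Pow (verts G)" by (auto simp: F_def)
  then have "finite F" using finite_subset finite_verts by blast
  moreover have "{} \<in> F" by (simp add: F_def)
  ultimately have "\<exists>Z\<in>F. \<forall>Y\<in>F. Z \<subseteq> Y \<longrightarrow> Z = Y"
    by (intro finite_has_maximal) blast+
  then obtain Z where ZF: "Z \<in> F" and Zmax: "\<And>Y. Y \<in> F \<Longrightarrow> Z \<subseteq> Y \<Longrightarrow> Z = Y"
    by blast
  have Z: "Z \<subseteq> verts G" "Z \<inter> mv ` Z = {}" "Z \<inter> U = {}"
    "\<forall>e\<in>arcs G. tail G e \<in> Z \<longrightarrow> head G e \<in> Z"
    using ZF by (auto simp: F_def)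
  have mvZ: "v \<in> mv ` Z \<longleftrightarrow> mv v \<in> Z" if "v \<in> verts G" for v
  proof
    show "v \<in> mv ` Z" if "mv v \<in> Z" using mv_mv[OF \<open>v \<in> verts G\<close>] that by (metis image_eqI)
    show "mv v \<in> Z" if "v \<in> mv ` Z" using Z that mv_mv by (auto simp: subset_iff)
  qed
  have enter: "tail G e \<in> mv ` Z" if "e \<in> arcs G" "head G e \<in> mv ` Z" for e
  proof -
    have "tail G (ma e) \<in> Z" using that mvZ by (simp add: tail_ma)
    then have "head G (ma e) \<in> Z" using Z ma_in_arcs[OF that(1)] by blast
    then show ?thesis using that mvZ by (simp add: head_ma)
  qed
  define S where "S = verts G - Z - mv ` Z"
  have S: "S \<subseteq> verts G" "\<And>v. v \<in> S \<Longrightarrow> mv v \<in> S"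
    using mvZ mv_in_verts mv_mv by (auto simp: S_def)
  have US: "U \<subseteq> S"
  proof
    fix v assume v: "v \<in> U"
    then have "v \<notin> Z" "mv v \<notin> Z" "v \<in> verts G" using U Z(3) by auto
    then show "v \<in> S" using mvZ by (simp add: S_def)
  qed
  interpret H: skew_symmetric_graph "G \<restriction> S" mv ma
    using skew_symmetric_graph_induce S by blast
  have "H.has_bridge"
  proof (rule H.weakly_acyclic_has_bridge)
    show "weakly_acyclic (G \<restriction> S) ma" using weakly_acyclic_induce wa S(1) .
    show "verts (G \<restriction> S) \<noteq> {}" using US U(2) by auto
    fix v assume "v \<in> verts (G \<restriction> S)"
    then have v: "v \<in> S" "v \<in> verts G" using S by auto
    show "\<exists>e\<in>arcs (G \<restriction> S). tail (G \<restriction> S) e = v"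
    \<comment> \<open>All arcs from \<open>v\<close> would end in \<open>Z\<close>, as none can
      enter the mates of \<open>Z\<close> from outside. Then \<open>insert v Z\<close> would
      contradict the maximality of \<open>Z\<close>.\<close>
    proof (rule ccontr)
      assume neg: "\<not> ?thesis"
      have vZ: "v \<notin> Z" "v \<notin> mv ` Z" using v by (auto simp: S_def)
      have "head G e \<in> Z" if e: "e \<in> arcs G" "tail G e = v" for e
      proof -
        have "head G e \<notin> S" using neg e v by auto
        moreover have "head G e \<notin> mv ` Z" using enter e vZ by auto
        ultimately show ?thesis using e by (auto simp: S_def)
      qed
      moreover have "v \<notin> U" using Uout[of v] US neg v by auto
      moreover have "mv v \<notin> Z" "mv v \<noteq> v" using mvZ v vZ mv_neq by auto
      ultimately have "insert v Z \<in> F" using Z v vZ by (auto simp: F_def)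
      then show False using Zmax[of "insert v Z"] vZ by auto
    qed
  qed
  then obtain X a where X: "X \<subseteq> S" "self_symmetric mv X" "X \<noteq> {}" "X \<noteq> S" and
    a: "a \<in> arcs (G \<restriction> S)" "connecting_arcs (G \<restriction> S) X (S - X) = {a, ma a}"
    by (auto simp: H.has_bridge_def)
  have "mv v \<in> X \<longleftrightarrow> v \<in> X" if "v \<in> S" for v
    using X(1,2) S(1) mv_mv that unfolding self_symmetric_def by (metis image_eqI subsetD)
  then have "self_symmetric mv (S - X)"
    using S by (intro self_symmetricI) auto
  moreover have "connecting_arcs G X (S - X) = {a, ma a}"
    using a(2) X(1) by (auto simp: connecting_arcs_def)
  moreover have "X \<union> (S - X) \<union> Z \<union> mv ` Z = verts G"
    using X(1) Z mv_in_verts by (auto simp: S_def)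
  moreover have "weakly_acyclic (G \<restriction> X) ma" "weakly_acyclic (G \<restriction> (S - X)) ma"
    using X(1) S(1) by (auto intro!: weakly_acyclic_induce[OF wa])
  ultimately have "weak_separator G mv ma X (S - X) Z"
    unfolding weak_separator_def using X a(1) Z enter by (auto simp: S_def)
  then show ?thesis by blast
qed

text \<open>The hypothesis \<open>sa\<close> matters: \<open>weak_separator\<close> does not
  restrict circuits inside \<open>Z\<close>, and such a circuit is regular, since its mate arcs lie
  among the mates of \<open>Z\<close>.\<close>

lemma weak_separator_imp_weakly_acyclic:
  assumes sep: "weak_separator G mv ma A B Z" and sa: "strongly_acyclic (G \<restriction> Z)"
  shows "weakly_acyclic G ma"
proof (rule ccontr)
  assume "\<not> ?thesis"
  then obtain u p where p: "awalk u p u" "p \<noteq> []" "distinct (tl (awalk_verts u p))" "regular ma p"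
    by (auto simp: weakly_acyclic_def cycle_def)
  have pa: "set p \<subseteq> arcs G" using p by auto
  have part: "A \<union> B \<union> Z \<union> mv ` Z = verts G" "A \<inter> B = {}"
    and Zout: "\<And>e. e \<in> arcs G \<Longrightarrow> tail G e \<in> Z \<Longrightarrow> head G e \<in> Z"
    and wA: "weakly_acyclic (G \<restriction> A) ma" and wB: "weakly_acyclic (G \<restriction> B) ma"
    using sep by (auto simp: weak_separator_def)
  obtain a where a: "connecting_arcs G A B = {a, ma a}"
    using sep by (auto simp: weak_separator_def)
  interpret GZ: wf_digraph "G \<restriction> Z" by auto
  \<comment> \<open>Stated for every closed walk, because the mates of \<open>Z\<close> are excluded
    by applying it to the mate of \<open>p\<close>.\<close>
  have noZ: "tail G e \<notin> Z" if q: "awalk w q w" "e \<in> set q" for w q e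
  proof
    assume e: "tail G e \<in> Z"
    have qa: "set q \<subseteq> arcs G" using q by auto
    have "tail G e' \<in> Z" if "e' \<in> set q" for e'
      using closed_awalk_leaves[OF q e that] Zout qa by blast
    then have "GZ.awalk w q w" using q(2) qa Zout by (intro awalk_induce_arcs[OF q(1)]) auto
    then have "GZ.closed_w q" using q(2) by (auto simp: GZ.closed_w_def)
    then show False using sa by (auto simp: strongly_acyclic_def)
  qed
  have noZ': "tail G e \<notin> mv ` Z" if "e \<in> set p" for e
  proof
    assume "tail G e \<in> mv ` Z"
    moreover have "tail G e \<in> head G ` set p" using closed_awalk_ends[OF p(1)] that by auto
    ultimately obtain e' where e': "e' \<in> set p" "head G e' \<in> mv ` Z" by auto
    then obtain z where z: "z \<in> Z" "head G e' = mv z" by auto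
    have "z \<in> verts G" using part z by auto
    then have "tail G (ma e') \<in> Z" using e' z pa mv_mv by (auto simp: tail_ma subset_iff)
    then show False using noZ[OF awalk_mate[OF p(1)], of "ma e'"] e' by auto
  qed
  have tAB: "tail G e \<in> A \<union> B" if "e \<in> set p" for e
    using noZ[OF p(1) that] noZ'[OF that] part that pa by (auto simp: subset_iff)
  have hAB: "head G e \<in> A \<union> B" if "e \<in> set p" for e
  proof -
    have "head G e \<in> tail G ` set p" using that closed_awalk_ends[OF p(1)] by blast
    then obtain e' where "e' \<in> set p" "head G e = tail G e'" by auto
    then show ?thesis using tAB[of e'] by simp
  qed
  have inside: "\<exists>e\<in>set p. tail G e \<notin> X" if "weakly_acyclic (G \<restriction> X) ma" for X
  proof (rule ccontr)
    assume neg: "\<not> ?thesis"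
    then have "head G e \<in> X" if "e \<in> set p" for e
      using that closed_awalk_ends[OF p(1)] by (metis image_eqI imageE)
    then have "pre_digraph.awalk (G \<restriction> X) u p u"
      using neg by (intro awalk_induce_arcs[OF p(1,2)]) auto
    then have "pre_digraph.cycle (G \<restriction> X) p"
      using p(2,3) compatible_awalk_verts[OF compatible_induce_subgraph, of G X]
      unfolding pre_digraph.cycle_def by auto
    then show False using that p(4) by (auto simp: weakly_acyclic_def)
  qed
  obtain eA eB where e: "eA \<in> set p" "tail G eA \<in> A" "eB \<in> set p" "tail G eB \<notin> A"
    using inside[OF wA] inside[OF wB] tAB by blast
  obtain e1 where e1: "e1 \<in> set p" "tail G e1 \<in> A" "head G e1 \<notin> A"
    using closed_awalk_leaves[OF p(1) e] by blast
  \<comment> \<open>Leaving the complement of \<open>A\<close> means returning to \<open>A\<close>.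
    This arc differs from \<open>e1\<close>, so together they exhaust the connecting pair.\<close>
  obtain e2 where e2: "e2 \<in> set p" "tail G e2 \<notin> A" "head G e2 \<in> A"
    using closed_awalk_leaves[OF p(1) e(3) _ e(1), of "- A"] e by auto
  have "e1 \<in> connecting_arcs G A B" "e2 \<in> connecting_arcs G A B"
    using e1 e2 tAB[OF e2(1)] hAB[OF e1(1)] pa by (auto simp: connecting_arcs_def)
  then have "e1 \<in> {a, ma a}" "e2 \<in> {a, ma a}" using a by auto
  moreover have "e1 \<noteq> e2" using e1 e2 by auto
  ultimately have "a \<in> set p" "ma a \<in> set p" using e1(1) e2(1) by auto
  then show False using p(4) by (auto simp: regular_def)
qed

end

theorem theorem3p1:
  fixes G :: "('a, 'b) pre_digraph" and mv :: "'a \<Rightarrow> 'a" and ma :: "'b \<Rightarrow> 'b"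
  assumes "skew_symmetric_graph G mv ma"
  shows "(weakly_acyclic G ma \<longrightarrow>
            strongly_acyclic G \<or> (\<exists>A B Z. weak_separator G mv ma A B Z)) \<and>
         (\<forall>A B Z. weak_separator G mv ma A B Z \<and> strongly_acyclic (G \<restriction> Z) \<longrightarrow>
            weakly_acyclic G ma)"
proof -
  interpret skew_symmetric_graph G mv ma by fact
  show ?thesis using weak_separator_exists weak_separator_imp_weakly_acyclic by blast
qed

end
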